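(* For each positive integer $n$, define a map $U$ on $C(n)$ as follows. Given $c \in C(n)$, append a final part $0$ if $c$ has odd length, so that $c=(c_1,\ldots,c_{2u})$. Replace each pair $(c_{2i-1},c_{2i})$, $1\le i\le u$, by \[ \begin{cases} (1^{c_{2i-1}-c_{2i}-1},\,2c_{2i}+1) & \text{if } c_{2i}-c_{2i-1}<0,\\ (1^{c_{2i-1}+c_{2i}-2k},\,2k) & \text{if } 2k-2 \le c_{2i}-c_{2i-1} < 2k \text{ for an integer } k\ge 1,\end{cases}\] and let $U(c)$ be the concatenation of these blocks in order. Then $U$ is a permutation (bijection) of $C(n)$.
   Context: $C(n)$ is the set of compositions of $n$, i.e., finite sequences of positive integers summing to $n$. The notation $1^m$ denotes $m$ consecutive parts equal to $1$ (nothing if $m=0$). In the first case with $c_{2i}=0$ (only possible for an appended final $0$), the block $(1^{c_{2i-1}-1},1)$ is simply $c_{2i-1}$ parts equal to $1$. *)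

theory Defs
  imports Main
begin

definition compositions :: "nat \<Rightarrow> nat list set" where
  "compositions n = {c. (\<forall>x\<in>set c. 0 < x) \<and> sum_list c = n}"

(* The difference b - a is taken in the integers, as it may be negative.
   On nat, the exponents a - b - 1 and a + b - 2 * k are only relied upon when they
   are nonnegative: in the first branch b < a, and in the second one
   2 * k \<le> b - a + 2 \<le> a + b because a \<ge> 1. *)
definition U_block :: "nat \<Rightarrow> nat \<Rightarrow> nat list" where
  "U_block a b =
     (if int b - int a < 0 then replicate (a - b - 1) 1 @ [2 * b + 1]
      else (let k = (THE k::nat. 1 \<le> k \<and> 2 * int k - 2 \<le> int b - int a
                                    \<and> int b - int a < 2 * int k)
            in replicate (a + b - 2 * k) 1 @ [2 * k]))"

lemma ex1_block_index:
  fixes a b :: nat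
  assumes "\<not> int b - int a < 0"
  shows "\<exists>!k::nat. 1 \<le> k \<and> 2 * int k - 2 \<le> int b - int a \<and> int b - int a < 2 * int k"
proof -
  from assms obtain d where b: "b = a + d"
    using le_Suc_ex[of a b] by auto
  show ?thesis
  proof (rule ex1I[where a = "d div 2 + 1"])
    show "1 \<le> d div 2 + 1 \<and> 2 * int (d div 2 + 1) - 2 \<le> int b - int a
        \<and> int b - int a < 2 * int (d div 2 + 1)"
      unfolding b by (auto simp: zdiv_int)
    show "k = d div 2 + 1"
      if "1 \<le> k \<and> 2 * int k - 2 \<le> int b - int a \<and> int b - int a < 2 * int k" for k
      using that unfolding b by presburger
  qed
qed

definition pad_even :: "nat list \<Rightarrow> nat list" where
  "pad_even c = (if odd (length c) then c @ [0] else c)"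

(* List indices start at 0, so the i-th pair is (d ! (2 * i), d ! (2 * i + 1)). *)
definition U :: "nat list \<Rightarrow> nat list" where
  "U c = (let d = pad_even c
          in concat (map (\<lambda>i. U_block (d ! (2 * i)) (d ! (2 * i + 1))) [0..<length d div 2]))"

end

theory Submission
  imports Defs
begin

text \<open>
  For positive \<open>a\<close> and \<open>b\<close> the map \<open>(a, b) \<mapsto> (1\<^sup>m, p)\<close> is a bijection onto
  the blocks with \<open>m \<ge> 0\<close> and \<open>p \<ge> 2\<close>: the parity of \<open>p\<close> tells which case was used.
  A lone last part \<open>a\<close> is sent to \<open>1\<^sup>a\<close>. Since every composition splits uniquely into
  blocks \<open>(1\<^sup>m, p)\<close> with \<open>p \<ge> 2\<close>, followed by a possibly empty run of ones, the
  inverse reads a composition from left to right while counting the current run of ones.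
\<close>

lemma U_block_less: "b < a \<Longrightarrow> U_block a b = replicate (a - b - 1) 1 @ [2 * b + 1]"
  by (simp add: U_block_def)

text \<open>The bounds \<open>2 * k - 2 \<le> b - a < 2 * k\<close> force \<open>k - 1\<close> to be
  the integer half of \<open>b - a\<close>; this explicit \<open>k\<close> replaces the definite
  description.\<close>

lemma U_block_ge:
  assumes "a \<le> b"
  defines "k \<equiv> (b - a) div 2 + 1"
  shows "U_block a b = replicate (a + b - 2 * k) 1 @ [2 * k]"
proof -
  let ?P = "\<lambda>k::nat. 1 \<le> k \<and> 2 * int k - 2 \<le> int b - int a \<and> int b - int a < 2 * int k"
  have "?P k"
    using assms by presburger
  then have "(THE k. ?P k) = k"
    using ex1_block_index[of b a] assms by (intro the1_equality) auto
  with assms(1) show ?thesis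
    by (simp add: U_block_def)
qed

lemma sum_list_U_block:
  assumes "0 < a"
  shows "sum_list (U_block a b) = a + b"
proof (cases "b < a")
  case False
  then have "2 * ((b - a) div 2 + 1) \<le> a + b"
    using assms by presburger
  with False show ?thesis
    by (simp add: U_block_ge sum_list_replicate)
qed (simp add: U_block_less sum_list_replicate)

lemma U_block_pos: "x \<in> set (U_block a b) \<Longrightarrow> 0 < x"
  by (cases "b < a") (auto simp: U_block_less U_block_ge split: if_splits)

lemma U_Nil: "U [] = []"
  by (simp add: U_def pad_even_def)

text \<open>The padding 0 lies below \<open>a\<close>, so the first case applies and its last part
  \<open>2 * 0 + 1\<close> is one more 1.\<close>

lemma U_single: "0 < a \<Longrightarrow> U [a] = replicate a 1"
  by (cases a) (simp_all add: U_def pad_even_def U_block_less replicate_append_same)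

text \<open>Removing a pair keeps the parity of the length, so padding commutes with it. This
  recursion replaces the indexed definition in the inductions.\<close>

lemma U_Cons_Cons: "U (a # b # c) = U_block a b @ U c"
proof -
  have pad: "pad_even (a # b # c) = a # b # pad_even c"
    by (simp add: pad_even_def)
  have "[0..<Suc (length (pad_even c) div 2)] = 0 # map Suc [0..<length (pad_even c) div 2]"
    by (simp add: upt_conv_Cons map_Suc_upt del: upt_Suc)
  then show ?thesis
    by (simp add: U_def Let_def pad comp_def del: upt_Suc)
qed

lemma U_compositions:
  assumes "\<forall>x\<in>set c. 0 < x"
  shows "(\<forall>x\<in>set (U c). 0 < x) \<and> sum_list (U c) = sum_list c"
  using assms
proof (induction c rule: induct_list012)
  case (3 a b c)
  then show ?case
    by (auto simp: U_Cons_Cons sum_list_U_block dest: U_block_pos)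
qed (auto simp: U_Nil U_single sum_list_replicate)

text \<open>Odd \<open>p\<close> is \<open>2 * b + 1\<close> with \<open>m = a - b - 1\<close>. Even
  \<open>p\<close> is \<open>2 * k\<close> with \<open>m = 2 * (a - 1) + (b - a) mod 2\<close>. Both
  are solved for \<open>a\<close> and \<open>b\<close>.\<close>

definition unblock :: "nat \<Rightarrow> nat \<Rightarrow> nat list" where
  "unblock m p = (if odd p then [m + p div 2 + 1, p div 2]
     else [m div 2 + 1, m div 2 + m mod 2 + p - 1])"

text \<open>\<open>m\<close> counts the ones read since the last larger part. Ones left at the end
  come from an unpaired last part; the test \<open>m = 0\<close> avoids creating a part 0.\<close>

fun unU :: "nat \<Rightarrow> nat list \<Rightarrow> nat list" where
  "unU m [] = (if m = 0 then [] else [m])"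
| "unU m (p # c) = (if p = 1 then unU (Suc m) c else unblock m p @ unU 0 c)"

lemma unU_replicate: "unU m (replicate j 1 @ c) = unU (m + j) c"
  by (induction j arbitrary: m) simp_all

lemma unU_U_block:
  assumes "0 < a" "0 < b"
  shows "unU 0 (U_block a b @ c) = a # b # unU 0 c"
proof (cases "b < a")
  case True
  then have "unblock (a - b - 1) (2 * b + 1) = [a, b]"
    by (simp add: unblock_def)
  then show ?thesis
    using True assms unU_replicate[of 0 "a - b - 1" "(2 * b + 1) # c"]
    by (simp add: U_block_less)
next
  case False
  obtain d where d: "b = a + d"
    using False le_Suc_ex[of a b] by auto
  define k m where "k = (b - a) div 2 + 1" and "m = a + b - 2 * k"
  \<comment> \<open>Halving loses the parity of \<open>d\<close> in \<open>k\<close>, but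
    \<open>m\<close> retains it, next to \<open>a\<close>.\<close>
  have "m = 2 * (a - 1) + d mod 2"
    using assms(1) minus_mod_eq_mult_div[of d 2] by (simp add: m_def k_def d algebra_simps)
  then have "m div 2 = a - 1" "m mod 2 = d mod 2"
    by simp_all
  then have "m div 2 + 1 = a" "m div 2 + m mod 2 + 2 * k - 1 = b"
    using assms(1) div_mult_mod_eq[of d 2] by (simp_all add: k_def d)
  then have "unblock m (2 * k) = [a, b]"
    by (simp add: unblock_def)
  then show ?thesis
    using False unU_replicate[of 0 m "(2 * k) # c"]
    by (simp add: U_block_ge k_def m_def)
qed

lemma unU_U:
  assumes "\<forall>x\<in>set c. 0 < x"
  shows "unU 0 (U c) = c"
  using assms
proof (induction c rule: induct_list012)
  case (2 a)
  then show ?case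
    using unU_replicate[of 0 a "[]"] by (simp add: U_single)
qed (simp_all add: U_Nil U_Cons_Cons unU_U_block)

lemma U_unblock:
  assumes "2 \<le> p"
  shows "U (unblock m p @ c) = replicate m 1 @ p # U c"
proof (cases "odd p")
  case True
  then show ?thesis
    by (simp add: unblock_def U_Cons_Cons U_block_less)
next
  case False
  define a b where "a = m div 2 + 1" and "b = m div 2 + m mod 2 + p - 1"
  \<comment> \<open>Here \<open>r\<close> is \<open>k - 1\<close>, so that \<open>b - a\<close>
    becomes \<open>m mod 2 + 2 * r\<close>, whose integer half is \<open>r\<close>.\<close>
  obtain r where p: "p = 2 * r + 2"
    using False assms by (metis add.commute evenE le_add_diff_inverse2 dvd_diff_nat dvd_refl)
  have b: "b = a + (m mod 2 + 2 * r)"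
    by (simp add: a_def b_def p)
  have "a + b = m + p"
    using div_mult_mod_eq[of m 2] by (simp add: b a_def p)
  then have "a \<le> b" "2 * ((b - a) div 2 + 1) = p" "a + b - p = m"
    by (simp_all add: b p)
  then have "U_block a b = replicate m 1 @ [p]"
    using U_block_ge[of a b] by simp
  with False show ?thesis
    by (simp add: unblock_def U_Cons_Cons a_def b_def)
qed

text \<open>Stated for every \<open>m\<close> because the induction moves leading ones of
  \<open>c\<close> into the counter.\<close>

lemma U_unU:
  assumes "\<forall>x\<in>set c. 0 < x"
  shows "U (unU m c) = replicate m 1 @ c"
  using assms
proof (induction c arbitrary: m)
  case (Cons p c)
  then show ?case
    by (cases "p = 1") (simp_all add: U_unblock replicate_app_Cons_same)
qed (simp add: U_Nil U_single)

lemma unblock_pos: "2 \<le> p \<Longrightarrow> x \<in> set (unblock m p) \<Longrightarrow> 0 < x"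
  by (auto simp: unblock_def split: if_splits)

lemma unU_pos:
  assumes "\<forall>x\<in>set c. 0 < x"
  shows "\<forall>x\<in>set (unU m c). 0 < x"
  using assms
proof (induction c arbitrary: m)
  case (Cons p c)
  then have "p = 1 \<or> 2 \<le> p"
    by auto
  with Cons show ?case
    by (auto dest: unblock_pos)
qed simp

theorem theorem3p1:
  fixes n :: nat
  assumes "0 < n"
  shows "bij_betw U (compositions n) (compositions n)"
proof (rule bij_betw_byWitness[where f' = "unU 0"])
  show "\<forall>c\<in>compositions n. unU 0 (U c) = c"
    by (simp add: compositions_def unU_U)
  show "\<forall>c\<in>compositions n. U (unU 0 c) = c"
    by (simp add: compositions_def U_unU)
  show "U ` compositions n \<subseteq> compositions n"
    using U_compositions by (auto simp: compositions_def)
  show "unU 0 ` compositions n \<subseteq> compositions n"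
  proof
    fix d assume "d \<in> unU 0 ` compositions n"
    then obtain c where c: "\<forall>x\<in>set c. 0 < x" "sum_list c = n" "d = unU 0 c"
      by (auto simp: compositions_def)
    then have "\<forall>x\<in>set d. 0 < x" "U d = c"
      using unU_pos[of c] U_unU[of c] by simp_all
    \<comment> \<open>Since \<open>U d = c\<close> and \<open>U\<close> preserves sums,
      \<open>d\<close> also sums to \<open>n\<close>.\<close>
    with c show "d \<in> compositions n"
      using U_compositions[of d] by (simp add: compositions_def)
  qed
qed

end
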